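(* Let $\mathbb{P}$ be a finite ordered set, $S$ an adequate partial semigroup, and $\alpha$ an action of $\mathbb{P}$ on $S$. Let $\xi\in(\gamma S)_\alpha$ be an order-preserving idempotent. Let $c$ be a finite coloring of $S$, extended canonically to $\beta S$. Let $(\psi^{(\mathcal F)}_n)_{n\in\omega}$ be functions $\psi^{(\mathcal F)}_n:(S^{\mathbb P})^n\to[\mathcal{F}_\alpha]^{<\aleph_0}$ and $(\psi^{(S)}_n)_{n\in\omega}$ functions $\psi^{(S)}_n:(S^{\mathbb P})^n\to[S]^{<\aleph_0}$ such that $\psi^{(S)}_n(x_0,\dots,x_{n-1})$ contains the range of $\tau_i\circ x_i$ for every $i<n$ and every $\tau_i\in\psi^{(\mathcal F)}_i(x_0,\dots,x_{i-1})$. Then there is a sequence $(x_n)_{n\in\omega}$ of functions $x_n:\mathbb{P}\to S$ such that: (a) $x_n(t)\in S_t\cap\varphi_S\big(\psi^{(S)}_n(x_0,\dots,x_{n-1})\big)$ for every $n\in\omega$ and $t\in\mathbb{P}$; (b) for every $\ell\in\omega$, $n_0<n_1<\cdots<n_\ell$ in $\omega$, $t_i\in\mathbb P$ ($i\le\ell$) and $\tau_i\in\psi^{(\mathcal F)}_{n_i}(x_0,\dots,x_{n_i-1})$ ($i\le\ell$), if $\{f_{\tau_i}(t_i):i\le\ell\}$ is a chain in $\mathbb{P}$ with least element $t$, then the color of $\tau_0(x_{n_0}(t_0))+\cdots+\tau_\ell(x_{n_\ell}(t_\ell))$ equals the color of $\xi(t)$.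
   Context: $\omega=\{0,1,\dots\}$, $n=\{0,\dots,n-1\}$, $[A]^{<\aleph_0}$ = finite subsets of $A$. A partial semigroup is a set $S$ with a partial operation $+$ satisfying $(x+y)+z=x+(y+z)$ (one side defined iff the other is, then equal). For finite $A\subseteq S$, $\varphi_S(A)=\{x\in S: a+x\text{ defined for all }a\in A\}$; $S$ is adequate if $\varphi_S(A)\neq\emptyset$ for every finite $A$. A partial semigroup homomorphism $f$ satisfies $f(x+y)=f(x)+f(y)$ (in the same sense); it is adequate if for every finite $B$ in the codomain there is a finite $A$ in the domain with $f(\varphi(A))\subseteq\varphi(B)$. An adequate partial subsemigroup of $S$ is a subset closed under $+$ (whenever defined) such that the inclusion map is an adequate homomorphism. These are ordered by $S_0\le S_1$ iff $s_0+s_1,s_1+s_0\in S_0$ whenever $s_i\in S_i$ and the sum is defined. $\mathrm{End}(S)$ is the semigroup of adequate homomorphisms $S\to S$. $\gamma S$ is the set of ultrafilters $\mathcal U$ on $S$ such that $\{y:x+y\text{ defined}\}\in\mathcal U$ for every $x\in S$; with the topology of $\beta S$ and the operation $A\in\mathcal{U}+\mathcal{V}$ iff $\{x:\{y: x+y\text{ defined},\ x+y\in A\}\in\mathcal V\}\in\mathcal U$, it is a compact Hausdorff right topological semigroup. $e$ is idempotent if $e+e=e$; for idempotents, $e\le e'$ iff $e+e'=e'+e=e$. Each $\tau\in\mathrm{End}(S)$ extends to a continuous homomorphism $\tau:\gamma S\to\gamma S$, $A\in\tau(\mathcal U)$ iff $\tau^{-1}(A)\in\mathcal U$. For an adequate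 partial subsemigroup $S_0$, $\gamma S_0$ is identified with $\{\mathcal U\in\gamma S:S_0\in\mathcal U\}$. A finite coloring $c:S\to n$ extends to $\beta S$ by $c(\mathcal U)=i$ iff $\{x:c(x)=i\}\in\mathcal U$. An action $\alpha$ of an ordered set $\mathbb P$ on $S$ consists of an order-preserving map $t\mapsto S_t$ into adequate partial subsemigroups of $S$ and a subsemigroup $\mathcal F_\alpha\subseteq\mathrm{End}(S)$, each $\tau\in\mathcal F_\alpha$ having a spine $f_\tau:\mathbb P\to\mathbb P$ with $\tau(S_t)\subseteq S_{f_\tau(t)}$ for all $t$ and $\tau(s)=s$ whenever $s\in S_t$ and $f_\tau(t)=t$. $(\gamma S)_\alpha$ is the set of $\xi:\mathbb P\to\gamma S$ with $\xi(t)\in\gamma S_t$ and $\tau\circ\xi=\xi\circ f_\tau$ for all $\tau\in\mathcal F_\alpha$; $\xi$ is an order-preserving idempotent if each $\xi(t)$ is idempotent and $\xi(t)\le\xi(t_0)$ whenever $t\le t_0$. *)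

theory Defs
  imports "HOL-Library.FuncSet"
begin

text \<open>
  The partial semigroup \<open>S\<close> is a whole type \<open>'a\<close> (an adequate partial semigroup is nonempty),
  with \<open>pl x y = None\<close> meaning that \<open>x + y\<close> is undefined. Its partial subsemigroups are sets.
\<close>

definition partial_semigroup :: "('a \<Rightarrow> 'a \<Rightarrow> 'a option) \<Rightarrow> bool" where
  "partial_semigroup pl \<longleftrightarrow>
     (\<forall>x y z. Option.bind (pl x y) (\<lambda>s. pl s z) = Option.bind (pl y z) (\<lambda>s. pl x s))"

definition phi :: "('a \<Rightarrow> 'a \<Rightarrow> 'a option) \<Rightarrow> 'a set \<Rightarrow> 'a set \<Rightarrow> 'a set" where
  "phi pl T A = {x \<in> T. \<forall>a\<in>A. pl a x \<noteq> None}"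

definition adequate :: "('a \<Rightarrow> 'a \<Rightarrow> 'a option) \<Rightarrow> bool" where
  "adequate pl \<longleftrightarrow> (\<forall>A. finite A \<longrightarrow> phi pl UNIV A \<noteq> {})"

text \<open>Adequate homomorphisms between subsets of \<open>S\<close> that are closed under \<open>+\<close>.\<close>

definition adequate_hom ::
  "('a \<Rightarrow> 'a \<Rightarrow> 'a option) \<Rightarrow> 'a set \<Rightarrow> 'a set \<Rightarrow> ('a \<Rightarrow> 'a) \<Rightarrow> bool" where
  "adequate_hom pl T T' h \<longleftrightarrow>
     h \<in> T \<rightarrow> T' \<and>
     (\<forall>x\<in>T. \<forall>y\<in>T. map_option h (pl x y) = pl (h x) (h y)) \<and>
     (\<forall>B\<subseteq>T'. finite B \<longrightarrow> (\<exists>A\<subseteq>T. finite A \<and> h ` phi pl T A \<subseteq> phi pl T' B))"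

definition adequate_subsemigroup :: "('a \<Rightarrow> 'a \<Rightarrow> 'a option) \<Rightarrow> 'a set \<Rightarrow> bool" where
  "adequate_subsemigroup pl T \<longleftrightarrow>
     (\<forall>x\<in>T. \<forall>y\<in>T. \<forall>s. pl x y = Some s \<longrightarrow> s \<in> T) \<and> adequate_hom pl T UNIV (\<lambda>x. x)"

definition subsemigroup_le :: "('a \<Rightarrow> 'a \<Rightarrow> 'a option) \<Rightarrow> 'a set \<Rightarrow> 'a set \<Rightarrow> bool" where
  "subsemigroup_le pl T0 T1 \<longleftrightarrow>
     (\<forall>x\<in>T0. \<forall>y\<in>T1. \<forall>s. pl x y = Some s \<or> pl y x = Some s \<longrightarrow> s \<in> T0)"

definition adequate_End :: "('a \<Rightarrow> 'a \<Rightarrow> 'a option) \<Rightarrow> ('a \<Rightarrow> 'a) set" where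
  "adequate_End pl = {\<tau>. adequate_hom pl UNIV UNIV \<tau>}"

text \<open>
  Ultrafilters are represented by library filters: \<open>A \<in> U\<close> is \<open>\<forall>\<^sub>F x in U. x \<in> A\<close>, and the
  continuous extension of a map \<open>\<tau>\<close> is \<open>filtermap \<tau>\<close>.
\<close>

definition ultrafilter :: "'a filter \<Rightarrow> bool" where
  "ultrafilter U \<longleftrightarrow> U \<noteq> bot \<and> (\<forall>Q. eventually Q U \<or> eventually (\<lambda>x. \<not> Q x) U)"

definition gamma :: "('a \<Rightarrow> 'a \<Rightarrow> 'a option) \<Rightarrow> 'a filter set" where
  "gamma pl = {U. ultrafilter U \<and> (\<forall>x. \<forall>\<^sub>F y in U. pl x y \<noteq> None)}"

text \<open>\<open>\<gamma>T\<close> for an adequate partial subsemigroup \<open>T\<close>, as a subset of \<open>\<gamma>S\<close>.\<close>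

definition gamma_sub :: "('a \<Rightarrow> 'a \<Rightarrow> 'a option) \<Rightarrow> 'a set \<Rightarrow> 'a filter set" where
  "gamma_sub pl T = {U \<in> gamma pl. \<forall>\<^sub>F x in U. x \<in> T}"

definition gamma_plus ::
  "('a \<Rightarrow> 'a \<Rightarrow> 'a option) \<Rightarrow> 'a filter \<Rightarrow> 'a filter \<Rightarrow> 'a filter" where
  "gamma_plus pl U V =
     Abs_filter (\<lambda>Q. \<forall>\<^sub>F x in U. \<forall>\<^sub>F y in V. \<exists>z. pl x y = Some z \<and> Q z)"

text \<open>
  On \<open>gamma pl\<close> the predicate under \<open>Abs_filter\<close> is a filter, so the following equation
  characterizes the sum.
\<close>

lemma eventually_gamma_plus:
  assumes "V \<in> gamma pl"
  shows "eventually Q (gamma_plus pl U V) \<longleftrightarrow>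
    (\<forall>\<^sub>F x in U. \<forall>\<^sub>F y in V. \<exists>z. pl x y = Some z \<and> Q z)"
  unfolding gamma_plus_def
proof (rule eventually_Abs_filter, rule is_filter.intro)
  show "\<forall>\<^sub>F x in U. \<forall>\<^sub>F y in V. \<exists>z. pl x y = Some z \<and> True"
    using assms by (simp add: gamma_def)
next
  fix Q R
  assume "\<forall>\<^sub>F x in U. \<forall>\<^sub>F y in V. \<exists>z. pl x y = Some z \<and> Q z"
    and "\<forall>\<^sub>F x in U. \<forall>\<^sub>F y in V. \<exists>z. pl x y = Some z \<and> R z"
  then show "\<forall>\<^sub>F x in U. \<forall>\<^sub>F y in V. \<exists>z. pl x y = Some z \<and> Q z \<and> R z"
    by (rule eventually_elim2) (erule (1) eventually_elim2, auto)
next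
  fix Q R :: "'a \<Rightarrow> bool"
  assume imp: "\<forall>z. Q z \<longrightarrow> R z"
    and "\<forall>\<^sub>F x in U. \<forall>\<^sub>F y in V. \<exists>z. pl x y = Some z \<and> Q z"
  then show "\<forall>\<^sub>F x in U. \<forall>\<^sub>F y in V. \<exists>z. pl x y = Some z \<and> R z"
    by (auto elim!: eventually_mono)
qed

definition gamma_idempotent :: "('a \<Rightarrow> 'a \<Rightarrow> 'a option) \<Rightarrow> 'a filter \<Rightarrow> bool" where
  "gamma_idempotent pl e \<longleftrightarrow> gamma_plus pl e e = e"

definition idempotent_le :: "('a \<Rightarrow> 'a \<Rightarrow> 'a option) \<Rightarrow> 'a filter \<Rightarrow> 'a filter \<Rightarrow> bool" where
  "idempotent_le pl e e' \<longleftrightarrow> gamma_plus pl e e' = e \<and> gamma_plus pl e' e = e"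

text \<open>
  The ordered set \<open>P\<close> is a subset of an ordered type, with the induced order; \<open>St t\<close>, \<open>F\<close> and
  \<open>f \<tau>\<close> are the subsemigroups, the set of endomorphisms and the spines of the action.
\<close>

definition semigroup_action ::
  "('a \<Rightarrow> 'a \<Rightarrow> 'a option) \<Rightarrow> 'p::order set \<Rightarrow> ('p \<Rightarrow> 'a set) \<Rightarrow> ('a \<Rightarrow> 'a) set \<Rightarrow>
    (('a \<Rightarrow> 'a) \<Rightarrow> 'p \<Rightarrow> 'p) \<Rightarrow> bool" where
  "semigroup_action pl P St F f \<longleftrightarrow>
     (\<forall>t\<in>P. adequate_subsemigroup pl (St t)) \<and>
     (\<forall>t\<in>P. \<forall>t'\<in>P. t \<le> t' \<longrightarrow> subsemigroup_le pl (St t) (St t')) \<and>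
     F \<subseteq> adequate_End pl \<and> (\<forall>\<sigma>\<in>F. \<forall>\<tau>\<in>F. \<sigma> \<circ> \<tau> \<in> F) \<and>
     (\<forall>\<tau>\<in>F. f \<tau> \<in> P \<rightarrow> P \<and>
        (\<forall>t\<in>P. \<tau> ` St t \<subseteq> St (f \<tau> t)) \<and>
        (\<forall>t\<in>P. f \<tau> t = t \<longrightarrow> (\<forall>s\<in>St t. \<tau> s = s)))"

definition gamma_action ::
  "('a \<Rightarrow> 'a \<Rightarrow> 'a option) \<Rightarrow> 'p::order set \<Rightarrow> ('p \<Rightarrow> 'a set) \<Rightarrow> ('a \<Rightarrow> 'a) set \<Rightarrow>
    (('a \<Rightarrow> 'a) \<Rightarrow> 'p \<Rightarrow> 'p) \<Rightarrow> ('p \<Rightarrow> 'a filter) set" where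
  "gamma_action pl P St F f =
     {\<xi> \<in> P \<rightarrow>\<^sub>E gamma pl.
        (\<forall>t\<in>P. \<xi> t \<in> gamma_sub pl (St t)) \<and>
        (\<forall>\<tau>\<in>F. \<forall>t\<in>P. filtermap \<tau> (\<xi> t) = \<xi> (f \<tau> t))}"

definition order_preserving_idempotent ::
  "('a \<Rightarrow> 'a \<Rightarrow> 'a option) \<Rightarrow> 'p::order set \<Rightarrow> ('p \<Rightarrow> 'a filter) \<Rightarrow> bool" where
  "order_preserving_idempotent pl P \<xi> \<longleftrightarrow>
     (\<forall>t\<in>P. gamma_idempotent pl (\<xi> t)) \<and>
     (\<forall>t\<in>P. \<forall>t0\<in>P. t \<le> t0 \<longrightarrow> idempotent_le pl (\<xi> t) (\<xi> t0))"

text \<open>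
  For a coloring \<open>c\<close> with finitely many values and an ultrafilter \<open>U\<close>, exactly one \<open>i\<close> qualifies.
\<close>

definition color_ext :: "('a \<Rightarrow> nat) \<Rightarrow> 'a filter \<Rightarrow> nat" where
  "color_ext c U = (THE i. \<forall>\<^sub>F x in U. c x = i)"

text \<open>\<open>n\<close>-tuples of functions from \<open>P\<close> to \<open>S\<close>.\<close>

definition tuples :: "'p set \<Rightarrow> nat \<Rightarrow> ('p \<Rightarrow> 'a) list set" where
  "tuples P n = {xs. length xs = n \<and> set xs \<subseteq> P \<rightarrow>\<^sub>E UNIV}"

text \<open>\<open>psum pl g l\<close> is \<open>g 0 + \<dots> + g l\<close>, or \<open>None\<close> if this is undefined.\<close>

primrec psum :: "('a \<Rightarrow> 'a \<Rightarrow> 'a option) \<Rightarrow> (nat \<Rightarrow> 'a) \<Rightarrow> nat \<Rightarrow> 'a option" where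
  "psum pl g 0 = Some (g 0)"
| "psum pl g (Suc l) = Option.bind (psum pl g l) (\<lambda>s. pl s (g (Suc l)))"

end

theory Submission
  imports Defs
begin

text \<open>
  This is the Galvin--Glazer argument carried out simultaneously for all chains of \<open>P\<close>. A partial
  sum \<open>s\<close> whose terms came from a chain \<open>C\<close> with least element \<open>m\<close> is called good if it has the
  color of \<open>\<xi> m\<close> and if, for every \<open>u\<close> comparable to all of \<open>C\<close>, adding \<open>\<xi> u\<close>-almost any \<open>y\<close> gives
  the color of \<open>\<xi> (min m u)\<close>. Because \<open>\<xi> u + \<xi> v = \<xi> (min u v)\<close> for comparable \<open>u\<close> and \<open>v\<close>,
  goodness is itself preserved by adding \<open>\<xi> u\<close>-almost any \<open>y\<close>. At each stage only finitely many
  good sums have been formed, and \<open>filtermap \<tau> (\<xi> t) = \<xi> (f \<tau> t)\<close>, so \<open>\<xi> t\<close>-almost any choice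
  of \<open>x\<^sub>n(t)\<close> keeps all of their extensions good.
\<close>

section \<open>Colors of ultrafilters\<close>

lemma eventually_color_ext:
  assumes "ultrafilter U" and "c \<in> UNIV \<rightarrow> {..<k}"
  shows "\<forall>\<^sub>F x in U. c x = color_ext c U"
proof -
  have nb: "U \<noteq> bot" and ult: "\<And>Q. eventually Q U \<or> eventually (\<lambda>x. \<not> Q x) U"
    using assms(1) by (auto simp: ultrafilter_def)
  \<comment> \<open>Otherwise \<open>U\<close> would contain the complements of the finitely many
    color classes, hence also their empty intersection.\<close>
  have "\<exists>i. \<forall>\<^sub>F x in U. c x = i"
  proof (rule ccontr)
    assume "\<nexists>i. \<forall>\<^sub>F x in U. c x = i"
    then have "\<forall>i\<in>{..<k}. \<forall>\<^sub>F x in U. c x \<noteq> i"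
      using ult by blast
    then have "\<forall>\<^sub>F x in U. \<forall>i\<in>{..<k}. c x \<noteq> i"
      by (simp add: eventually_ball_finite)
    then have "\<forall>\<^sub>F x in U. False"
      by (rule eventually_mono) (use assms(2) in auto)
    then show False
      using nb by (simp add: trivial_limit_def)
  qed
  then obtain i where i: "\<forall>\<^sub>F x in U. c x = i" by blast
  have "j = i" if "\<forall>\<^sub>F x in U. c x = j" for j
  proof -
    have "\<forall>\<^sub>F x in U. j = i"
      using that i by eventually_elim simp
    then show ?thesis
      using nb by (simp add: eventually_const)
  qed
  with i have "color_ext c U = i"
    unfolding color_ext_def by (intro the_equality)
  with i show ?thesis by simp
qed

section \<open>Comparable positions and good sums\<close>

abbreviation comparable :: "'p::order \<Rightarrow> 'p \<Rightarrow> bool" where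
  "comparable u v \<equiv> u \<le> v \<or> v \<le> u"

text \<open>The library's \<open>min\<close> is usable here: \<open>min u v\<close> is the lesser one whenever \<open>u\<close> and \<open>v\<close> are
  comparable.\<close>

definition good_sum ::
  "('a \<Rightarrow> 'a \<Rightarrow> 'a option) \<Rightarrow> 'p::order set \<Rightarrow> ('p \<Rightarrow> 'a filter) \<Rightarrow> ('a \<Rightarrow> nat) \<Rightarrow>
    'p set \<Rightarrow> 'p \<Rightarrow> 'a \<Rightarrow> bool" where
  "good_sum pl P \<xi> c C m s \<longleftrightarrow>
     c s = color_ext c (\<xi> m) \<and>
     (\<forall>u\<in>P. (\<forall>w\<in>C. comparable u w) \<longrightarrow>
        (\<forall>\<^sub>F y in \<xi> u. \<exists>z. pl s y = Some z \<and> c z = color_ext c (\<xi> (min u m))))"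

text \<open>If \<open>u \<le> v\<close>, the first equation of \<open>idempotent_le\<close> for
  \<open>\<xi> u\<close> and \<open>\<xi> v\<close> applies; if \<open>v \<le> u\<close>, the second
  equation for \<open>\<xi> v\<close> and \<open>\<xi> u\<close> does.\<close>

lemma order_preserving_idempotent_plus:
  assumes "order_preserving_idempotent pl P \<xi>" "u \<in> P" "v \<in> P" "comparable u v"
  shows "gamma_plus pl (\<xi> u) (\<xi> v) = \<xi> (min v u)"
  using assms by (auto simp: order_preserving_idempotent_def idempotent_le_def min_def)

text \<open>Reading \<open>\<xi> (min v u)\<close> as a sum trades one quantifier for two nested
  ones, so the first term can be fixed before the second is known.\<close>

lemma eventually_order_preserving_idempotent:
  assumes "order_preserving_idempotent pl P \<xi>" "u \<in> P" "v \<in> P" "comparable u v"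
    and "\<xi> v \<in> gamma pl" and "\<forall>\<^sub>F z in \<xi> (min v u). Q z"
  shows "\<forall>\<^sub>F x in \<xi> u. \<forall>\<^sub>F y in \<xi> v. \<exists>z. pl x y = Some z \<and> Q z"
  using assms eventually_gamma_plus[of "\<xi> v" pl Q "\<xi> u"]
    order_preserving_idempotent_plus[of pl P \<xi> u v] by simp

lemma eventually_good_sum_singleton:
  assumes "finite P" and "order_preserving_idempotent pl P \<xi>" and "\<And>t. t \<in> P \<Longrightarrow> \<xi> t \<in> gamma pl"
    and "c \<in> UNIV \<rightarrow> {..<k}" and "u \<in> P"
  shows "\<forall>\<^sub>F y in \<xi> u. good_sum pl P \<xi> c {u} u y"
proof -
  have col: "\<forall>\<^sub>F x in \<xi> t. c x = color_ext c (\<xi> t)" if "t \<in> P" for t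
    using eventually_color_ext assms(3,4) that by (auto simp: gamma_def)
  have "\<forall>\<^sub>F y in \<xi> u. \<forall>v\<in>P. comparable v u \<longrightarrow>
      (\<forall>\<^sub>F y' in \<xi> v. \<exists>z. pl y y' = Some z \<and> c z = color_ext c (\<xi> (min v u)))"
  proof (rule eventually_ball_finite[OF assms(1)], rule ballI)
    fix v assume v: "v \<in> P"
    show "\<forall>\<^sub>F y in \<xi> u. comparable v u \<longrightarrow>
      (\<forall>\<^sub>F y' in \<xi> v. \<exists>z. pl y y' = Some z \<and> c z = color_ext c (\<xi> (min v u)))"
    proof (cases "comparable v u")
      case True
      have "min v u \<in> P"
        using v assms(5) by (simp add: min_def)
      from eventually_order_preserving_idempotent[OF assms(2,5) v _ assms(3)[OF v] col[OF this]] True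
      show ?thesis by auto
    qed simp
  qed
  with col[OF assms(5)] show ?thesis
    by eventually_elim (simp add: good_sum_def)
qed

text \<open>For a later position \<open>v\<close>, goodness of \<open>s\<close> is used at
  \<open>min v u\<close>, whose ultrafilter is \<open>\<xi> u + \<xi> v\<close>. Finiteness of
  \<open>P\<close> treats all \<open>v\<close> at once.\<close>

lemma eventually_good_sum_insert:
  assumes "finite P" and "partial_semigroup pl" and "order_preserving_idempotent pl P \<xi>"
    and "\<And>t. t \<in> P \<Longrightarrow> \<xi> t \<in> gamma pl"
    and "u \<in> P" and "\<forall>w\<in>C. comparable u w" and "m \<in> C" and "good_sum pl P \<xi> c C m s"
  shows "\<forall>\<^sub>F y in \<xi> u. \<exists>z. pl s y = Some z \<and> good_sum pl P \<xi> c (insert u C) (min u m) z"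
proof -
  have good: "\<forall>\<^sub>F y in \<xi> v. \<exists>z. pl s y = Some z \<and> c z = color_ext c (\<xi> (min v m))"
    if "v \<in> P" "\<forall>w\<in>C. comparable v w" for v
    using assms(8) that by (auto simp: good_sum_def)
  have "\<forall>\<^sub>F y in \<xi> u. \<forall>v\<in>P. (\<forall>w\<in>insert u C. comparable v w) \<longrightarrow>
      (\<forall>\<^sub>F y' in \<xi> v. \<exists>w. pl y y' = Some w \<and>
         (\<exists>z. pl s w = Some z \<and> c z = color_ext c (\<xi> (min (min v u) m))))"
  proof (rule eventually_ball_finite[OF assms(1)], rule ballI)
    fix v assume v: "v \<in> P"
    show "\<forall>\<^sub>F y in \<xi> u. (\<forall>w\<in>insert u C. comparable v w) \<longrightarrow>
      (\<forall>\<^sub>F y' in \<xi> v. \<exists>w. pl y y' = Some w \<and>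
         (\<exists>z. pl s w = Some z \<and> c z = color_ext c (\<xi> (min (min v u) m))))"
    proof (cases "\<forall>w\<in>insert u C. comparable v w")
      case True
      \<comment> \<open>Being one of \<open>u\<close> and \<open>v\<close>, \<open>min v u\<close>
        inherits their comparability with all of \<open>C\<close>.\<close>
      then have "min v u \<in> P" "\<forall>w\<in>C. comparable (min v u) w" "comparable u v"
        using v assms(5,6) by (auto simp: min_def)
      with eventually_order_preserving_idempotent[OF assms(3,5) v _ assms(4)[OF v] good]
      show ?thesis by auto
    next
      case False
      then show ?thesis by (intro always_eventually) blast
    qed
  qed
  with good[OF assms(5,6)] show ?thesis
  proof eventually_elim
    case (elim y)
    then obtain z where z: "pl s y = Some z" "c z = color_ext c (\<xi> (min u m))" by blast
    have "\<forall>\<^sub>F y' in \<xi> v. \<exists>w. pl z y' = Some w \<and> c w = color_ext c (\<xi> (min v (min u m)))"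
      if v: "v \<in> P" "\<forall>w\<in>insert u C. comparable v w" for v
    proof -
      \<comment> \<open>In a partial order \<open>min\<close> need not be associative; pairwise
        comparability makes it so for these three elements.\<close>
      have "comparable v u" "comparable v m" "comparable u m"
        using v(2) assms(6,7) by auto
      then have min_eq: "min (min v u) m = min v (min u m)"
        by (auto simp: min_def)
      \<comment> \<open>This rebrackets \<open>s + (y + y')\<close> as \<open>(s + y) + y'\<close>,
        including whether it is defined.\<close>
      have assoc: "pl z y' = pl s w" if "pl y y' = Some w" for y' w
        using assms(2)[unfolded partial_semigroup_def, rule_format, of s y y'] z(1) that by simp
      from elim(2) v have "\<forall>\<^sub>F y' in \<xi> v. \<exists>w. pl y y' = Some w \<and>
         (\<exists>z. pl s w = Some z \<and> c z = color_ext c (\<xi> (min (min v u) m)))" by blast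
      then show ?thesis
        unfolding min_eq by (rule eventually_mono) (auto simp: assoc)
    qed
    with z show ?case by (auto simp: good_sum_def)
  qed
qed

text \<open>A triple \<open>(s, C, m)\<close> records a partial sum \<open>s\<close>, the set \<open>C\<close> of positions \<open>f \<tau>\<^sub>i t\<^sub>i\<close> of its
  terms, and the least element \<open>m\<close> of \<open>C\<close>.\<close>

definition good_triples ::
  "('a \<Rightarrow> 'a \<Rightarrow> 'a option) \<Rightarrow> 'p::order set \<Rightarrow> ('p \<Rightarrow> 'a filter) \<Rightarrow> ('a \<Rightarrow> nat) \<Rightarrow>
    ('a \<times> 'p set \<times> 'p) set" where
  "good_triples pl P \<xi> c =
     {(s, C, m). m \<in> C \<and> (\<forall>w\<in>C. m \<le> w) \<and> good_sum pl P \<xi> c C m s}"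

text \<open>Keeping \<open>R\<close> inside \<open>R'\<close> serves sums that skip this stage. Only
  lower bounds on \<open>R'\<close> are imposed; goodness of its members is tracked
  separately.\<close>

definition extends_triples ::
  "('a \<Rightarrow> 'a \<Rightarrow> 'a option) \<Rightarrow> 'p::order set \<Rightarrow> (('a \<Rightarrow> 'a) \<Rightarrow> 'p \<Rightarrow> 'p) \<Rightarrow> ('a \<Rightarrow> 'a) set \<Rightarrow>
    ('p \<Rightarrow> 'a) \<Rightarrow> ('a \<times> 'p set \<times> 'p) set \<Rightarrow> ('a \<times> 'p set \<times> 'p) set \<Rightarrow> bool" where
  "extends_triples pl P f T y R R' \<longleftrightarrow>
     R \<subseteq> R' \<and>
     (\<forall>t\<in>P. \<forall>\<tau>\<in>T. (\<tau> (y t), {f \<tau> t}, f \<tau> t) \<in> R' \<and>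
        (\<forall>(s, C, m)\<in>R. (\<forall>w\<in>C. comparable (f \<tau> t) w) \<longrightarrow>
           (\<exists>z. pl s (\<tau> (y t)) = Some z \<and> (z, insert (f \<tau> t) C, min (f \<tau> t) m) \<in> R')))"

section \<open>One stage of the construction\<close>

lemma exists_next:
  assumes "finite P" and "partial_semigroup pl" and "semigroup_action pl P St F f"
    and "\<xi> \<in> gamma_action pl P St F f" and "order_preserving_idempotent pl P \<xi>"
    and "c \<in> UNIV \<rightarrow> {..<k}"
    and "finite T" "T \<subseteq> F" "finite A" "finite R" "R \<subseteq> good_triples pl P \<xi> c"
  shows "\<exists>y R'. y \<in> P \<rightarrow>\<^sub>E UNIV \<and> (\<forall>t\<in>P. y t \<in> St t \<inter> phi pl UNIV A) \<and>
    finite R' \<and> R' \<subseteq> good_triples pl P \<xi> c \<and> extends_triples pl P f T y R R'"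
proof -
  have gam: "\<And>t. t \<in> P \<Longrightarrow> \<xi> t \<in> gamma pl"
    and sub: "\<And>t. t \<in> P \<Longrightarrow> \<forall>\<^sub>F y in \<xi> t. y \<in> St t"
    and fm: "\<And>\<tau> t. \<tau> \<in> T \<Longrightarrow> t \<in> P \<Longrightarrow> filtermap \<tau> (\<xi> t) = \<xi> (f \<tau> t)"
    using assms(4,8) by (auto simp: gamma_action_def gamma_sub_def)
  have fP: "\<And>\<tau> t. \<tau> \<in> T \<Longrightarrow> t \<in> P \<Longrightarrow> f \<tau> t \<in> P"
    using assms(3,8) by (simp add: semigroup_action_def Pi_iff subset_eq)
  \<comment> \<open>The condition depends on the position \<open>u\<close> alone, not on the
    \<open>\<tau>\<close> and \<open>t\<close> with \<open>u = f \<tau> t\<close> that produce the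
    term.\<close>
  define ok where "ok = (\<lambda>u y. good_sum pl P \<xi> c {u} u y \<and>
     (\<forall>r\<in>R. case r of (s, C, m) \<Rightarrow> (\<forall>w\<in>C. comparable u w) \<longrightarrow>
        (\<exists>z. pl s y = Some z \<and> good_sum pl P \<xi> c (insert u C) (min u m) z)))"
  have ok: "\<forall>\<^sub>F y in \<xi> u. ok u y" if u: "u \<in> P" for u
    unfolding ok_def
  proof (intro eventually_conj eventually_ball_finite[OF assms(10)] ballI)
    show "\<forall>\<^sub>F y in \<xi> u. good_sum pl P \<xi> c {u} u y"
      using eventually_good_sum_singleton[OF assms(1,5) gam assms(6) u] .
    fix r assume r: "r \<in> R"
    obtain s C m where r_eq: "r = (s, C, m)" by (cases r)
    show "\<forall>\<^sub>F y in \<xi> u. case r of (s, C, m) \<Rightarrow> (\<forall>w\<in>C. comparable u w) \<longrightarrow>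
        (\<exists>z. pl s y = Some z \<and> good_sum pl P \<xi> c (insert u C) (min u m) z)"
    proof (cases "\<forall>w\<in>C. comparable u w")
      case True
      have "m \<in> C" "good_sum pl P \<xi> c C m s"
        using r assms(11) r_eq by (auto simp: good_triples_def)
      from eventually_good_sum_insert[OF assms(1,2,5) gam u True this] True show ?thesis
        by (simp add: r_eq)
    qed (auto simp: r_eq)
  qed
  have "\<exists>y. y \<in> St t \<and> y \<in> phi pl UNIV A \<and> (\<forall>\<tau>\<in>T. ok (f \<tau> t) (\<tau> y))" if t: "t \<in> P" for t
  proof -
    have "\<forall>\<^sub>F y in \<xi> t. \<forall>a\<in>A. pl a y \<noteq> None"
      using gam[OF t] by (intro eventually_ball_finite[OF assms(9)]) (auto simp: gamma_def)
    moreover have "\<forall>\<^sub>F y in \<xi> t. \<forall>\<tau>\<in>T. ok (f \<tau> t) (\<tau> y)"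
    proof (rule eventually_ball_finite[OF assms(7)], rule ballI)
      fix \<tau> assume \<tau>: "\<tau> \<in> T"
      show "\<forall>\<^sub>F y in \<xi> t. ok (f \<tau> t) (\<tau> y)"
        \<comment> \<open>Since \<open>\<tau>\<close> maps \<open>\<xi> t\<close> to
          \<open>\<xi> (f \<tau> t)\<close>, a property of almost all terms at position
          \<open>f \<tau> t\<close> pulls back to almost all \<open>y\<close>.\<close>
        using ok[OF fP[OF \<tau> t]] by (simp flip: fm[OF \<tau> t] add: eventually_filtermap)
    qed
    moreover note sub[OF t]
    ultimately have "\<forall>\<^sub>F y in \<xi> t. y \<in> St t \<and> y \<in> phi pl UNIV A \<and> (\<forall>\<tau>\<in>T. ok (f \<tau> t) (\<tau> y))"
      by eventually_elim (simp add: phi_def)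
    moreover have "\<xi> t \<noteq> bot"
      using gam[OF t] by (simp add: gamma_def ultrafilter_def)
    ultimately show ?thesis
      using eventually_happens by blast
  qed
  then obtain y0 where y0: "\<And>t. t \<in> P \<Longrightarrow>
      y0 t \<in> St t \<and> y0 t \<in> phi pl UNIV A \<and> (\<forall>\<tau>\<in>T. ok (f \<tau> t) (\<tau> (y0 t)))"
    by metis
  define y where "y = restrict y0 P"
  have y: "y \<in> P \<rightarrow>\<^sub>E UNIV" "\<forall>t\<in>P. y t \<in> St t \<inter> phi pl UNIV A"
    using y0 by (auto simp: y_def)
  have ok_y: "ok (f \<tau> t) (\<tau> (y t))" if "t \<in> P" "\<tau> \<in> T" for \<tau> t
    using y0 that by (simp add: y_def)
  have ok_sum: "\<exists>z. pl s (\<tau> (y t)) = Some z \<and>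
      good_sum pl P \<xi> c (insert (f \<tau> t) C) (min (f \<tau> t) m) z"
    if "t \<in> P" "\<tau> \<in> T" "(s, C, m) \<in> R" "\<forall>w\<in>C. comparable (f \<tau> t) w" for \<tau> t s C m
    using bspec[OF ok_y[OF that(1,2), unfolded ok_def, THEN conjunct2] that(3)] that(4) by simp
  \<comment> \<open>\<open>R1\<close> holds the sums started at this stage, \<open>R2\<close> the
    older sums lengthened by one term. The comparability guard in \<open>R2\<close> lets
    \<open>ok_sum\<close> ensure that \<open>the\<close> is applied to a defined sum.\<close>
  define R1 where "R1 = (\<lambda>(t, \<tau>). (\<tau> (y t), {f \<tau> t}, f \<tau> t)) ` (P \<times> T)"
  define R2 where "R2 = (\<lambda>((t, \<tau>), (s, C, m)).
      (the (pl s (\<tau> (y t))), insert (f \<tau> t) C, min (f \<tau> t) m)) `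
      {((t, \<tau>), (s, C, m)). t \<in> P \<and> \<tau> \<in> T \<and> (s, C, m) \<in> R \<and> (\<forall>w\<in>C. comparable (f \<tau> t) w)}"
  have "finite {((t, \<tau>), (s, C, m)). t \<in> P \<and> \<tau> \<in> T \<and> (s, C, m) \<in> R \<and>
      (\<forall>w\<in>C. comparable (f \<tau> t) w)}"
    by (rule finite_subset[of _ "(P \<times> T) \<times> R"]) (use assms(1,7,10) in auto)
  then have fin: "finite (R \<union> R1 \<union> R2)"
    using assms(1,7,10) by (simp add: R1_def R2_def)
  have "R1 \<subseteq> good_triples pl P \<xi> c"
    using ok_y by (auto simp: R1_def good_triples_def ok_def)
  moreover have "R2 \<subseteq> good_triples pl P \<xi> c"
  proof
    fix r assume "r \<in> R2"
    then obtain t \<tau> s C m where r: "r = (the (pl s (\<tau> (y t))), insert (f \<tau> t) C, min (f \<tau> t) m)"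
      and h: "t \<in> P" "\<tau> \<in> T" "(s, C, m) \<in> R" "\<forall>w\<in>C. comparable (f \<tau> t) w"
      unfolding R2_def by auto
    have m: "m \<in> C" "\<forall>w\<in>C. m \<le> w"
      using h(3) assms(11) by (auto simp: good_triples_def)
    have "\<forall>w\<in>insert (f \<tau> t) C. min (f \<tau> t) m \<le> w"
      using m h(4) by (auto simp: min_def intro: order_trans)
    moreover have "min (f \<tau> t) m \<in> insert (f \<tau> t) C"
      using m by (simp add: min_def)
    ultimately show "r \<in> good_triples pl P \<xi> c"
      using ok_sum[OF h] by (auto simp: r good_triples_def)
  qed
  moreover have "extends_triples pl P f T y R (R \<union> R1 \<union> R2)"
  proof -
    have "\<exists>z. pl s (\<tau> (y t)) = Some z \<and> (z, insert (f \<tau> t) C, min (f \<tau> t) m) \<in> R2"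
      if h: "t \<in> P" "\<tau> \<in> T" "(s, C, m) \<in> R" "\<forall>w\<in>C. comparable (f \<tau> t) w" for t \<tau> s C m
    proof -
      obtain z where z: "pl s (\<tau> (y t)) = Some z"
        using ok_sum[OF h] by blast
      have "(z, insert (f \<tau> t) C, min (f \<tau> t) m) \<in> R2"
        unfolding R2_def by (rule image_eqI[of _ _ "((t, \<tau>), (s, C, m))"]) (use h z in auto)
      with z show ?thesis by blast
    qed
    then show ?thesis
      unfolding extends_triples_def by (auto simp: R1_def) blast
  qed
  ultimately show ?thesis
    using y fin assms(11) by (intro exI[of _ y] exI[of _ "R \<union> R1 \<union> R2"]) simp
qed

section \<open>From single stages to the whole sequence\<close>

text \<open>By induction on \<open>l\<close>, the sum up to \<open>l\<close> is recorded before
  \<open>x (n (Suc l))\<close> is chosen, so that choice extends it. The value of \<open>m\<close>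
  stays open, since membership in \<open>good_triples\<close> determines it later.\<close>

lemma psum_in_triples:
  assumes ext: "\<And>n. extends_triples pl P f (T n) (x n) (R n) (R (Suc n))"
    and "strict_mono_on {..l} n"
    and "\<forall>i\<le>l. t i \<in> P" and "\<forall>i\<le>l. \<tau> i \<in> T (n i)"
    and "Complete_Partial_Order.chain (\<le>) ((\<lambda>i. f (\<tau> i) (t i)) ` {..l})"
  shows "\<exists>s m. psum pl (\<lambda>i. \<tau> i (x (n i) (t i))) l = Some s \<and>
    (s, (\<lambda>i. f (\<tau> i) (t i)) ` {..l}, m) \<in> R (Suc (n l))"
  using assms(2-)
proof (induction l)
  case 0
  then show ?case
    using ext[of "n 0"] by (auto simp: extends_triples_def)
next
  case (Suc l)
  let ?C = "(\<lambda>i. f (\<tau> i) (t i)) ` {..l}" and ?u = "f (\<tau> (Suc l)) (t (Suc l))"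
  have C: "(\<lambda>i. f (\<tau> i) (t i)) ` {..Suc l} = insert ?u ?C"
    by (auto simp: atMost_Suc)
  have "strict_mono_on {..l} n"
    using Suc.prems(1) by (auto simp: strict_mono_on_def)
  moreover have "Complete_Partial_Order.chain (\<le>) ?C"
    using Suc.prems(4) unfolding C by (auto simp: chain_def)
  ultimately obtain s m where s: "psum pl (\<lambda>i. \<tau> i (x (n i) (t i))) l = Some s"
      "(s, ?C, m) \<in> R (Suc (n l))"
    using Suc.IH Suc.prems(2,3) by fastforce
  \<comment> \<open>\<open>R i\<close> records the sums formed before stage \<open>i\<close>.
    Strictness of \<open>n\<close> and monotonicity of \<open>R\<close> carry the old sum across
    skipped stages.\<close>
  have "Suc (n l) \<le> n (Suc l)"
    using Suc.prems(1) by (auto simp: strict_mono_on_def Suc_le_eq)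
  moreover have "R i \<subseteq> R (Suc i)" for i
    using ext[of i] by (simp add: extends_triples_def)
  note lift_Suc_mono_le[of R, OF this]
  ultimately have "R (Suc (n l)) \<subseteq> R (n (Suc l))" by blast
  with s have sR: "(s, ?C, m) \<in> R (n (Suc l))" by blast
  have cmp: "\<forall>w\<in>?C. comparable ?u w"
    using Suc.prems(4) unfolding C by (auto simp: chain_def)
  have "t (Suc l) \<in> P" "\<tau> (Suc l) \<in> T (n (Suc l))"
    using Suc.prems(2,3) by auto
  with ext[of "n (Suc l)"] sR cmp obtain z
    where "pl s (\<tau> (Suc l) (x (n (Suc l)) (t (Suc l)))) = Some z"
      "(z, insert ?u ?C, min ?u m) \<in> R (Suc (n (Suc l)))"
    unfolding extends_triples_def by blast
  with s(1) show ?case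
    unfolding C by auto
qed

theorem theorem3p2:
  fixes pl :: "'a \<Rightarrow> 'a \<Rightarrow> 'a option"
    and P :: "'p::order set"
    and St :: "'p \<Rightarrow> 'a set"
    and F :: "('a \<Rightarrow> 'a) set"
    and f :: "('a \<Rightarrow> 'a) \<Rightarrow> 'p \<Rightarrow> 'p"
    and \<xi> :: "'p \<Rightarrow> 'a filter"
    and k :: nat
    and c :: "'a \<Rightarrow> nat"
    and \<psi>F :: "nat \<Rightarrow> ('p \<Rightarrow> 'a) list \<Rightarrow> ('a \<Rightarrow> 'a) set"
    and \<psi>S :: "nat \<Rightarrow> ('p \<Rightarrow> 'a) list \<Rightarrow> 'a set"
  assumes "finite P"
    and "partial_semigroup pl" and "adequate pl"
    and "semigroup_action pl P St F f"
    and "\<xi> \<in> gamma_action pl P St F f"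
    and "order_preserving_idempotent pl P \<xi>"
    and "c \<in> UNIV \<rightarrow> {..<k}"
    and "\<And>n xs. xs \<in> tuples P n \<Longrightarrow> finite (\<psi>F n xs) \<and> \<psi>F n xs \<subseteq> F"
    and "\<And>n xs. xs \<in> tuples P n \<Longrightarrow> finite (\<psi>S n xs)"
    and "\<And>n xs i \<tau>. xs \<in> tuples P n \<Longrightarrow> i < n \<Longrightarrow> \<tau> \<in> \<psi>F i (take i xs) \<Longrightarrow>
           (\<tau> \<circ> (xs ! i)) ` P \<subseteq> \<psi>S n xs"
  shows "\<exists>x :: nat \<Rightarrow> 'p \<Rightarrow> 'a.
    (\<forall>n. x n \<in> P \<rightarrow>\<^sub>E UNIV) \<and>
    (\<forall>n. \<forall>t\<in>P. x n t \<in> St t \<inter> phi pl UNIV (\<psi>S n (map x [0..<n]))) \<and>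
    (\<forall>(l::nat) (n :: nat \<Rightarrow> nat) (t :: nat \<Rightarrow> 'p) (\<tau> :: nat \<Rightarrow> 'a \<Rightarrow> 'a) (tmin :: 'p).
       strict_mono_on {..l} n \<longrightarrow>
       (\<forall>i\<le>l. t i \<in> P) \<longrightarrow>
       (\<forall>i\<le>l. \<tau> i \<in> \<psi>F (n i) (map x [0..<n i])) \<longrightarrow>
       Complete_Partial_Order.chain (\<le>) ((\<lambda>i. f (\<tau> i) (t i)) ` {..l}) \<longrightarrow>
       tmin \<in> (\<lambda>i. f (\<tau> i) (t i)) ` {..l} \<longrightarrow>
       (\<forall>i\<le>l. tmin \<le> f (\<tau> i) (t i)) \<longrightarrow>
       (\<exists>s. psum pl (\<lambda>i. \<tau> i (x (n i) (t i))) l = Some s \<and> c s = color_ext c (\<xi> tmin)))"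
proof -
  \<comment> \<open>The state pairs the tuple chosen so far, the argument of \<open>\<psi>F\<close>
    and \<open>\<psi>S\<close>, with the recorded sums; dependent choice then runs over such states,
    starting from no sums.\<close>
  define inv where "inv = (\<lambda>n (xs :: ('p \<Rightarrow> 'a) list, R).
     xs \<in> tuples P n \<and> finite R \<and> R \<subseteq> good_triples pl P \<xi> c)"
  define step where "step = (\<lambda>n (xs, R) (xs', R'). \<exists>y. xs' = xs @ [y] \<and> y \<in> P \<rightarrow>\<^sub>E UNIV \<and>
     (\<forall>t\<in>P. y t \<in> St t \<inter> phi pl UNIV (\<psi>S n xs)) \<and>
     extends_triples pl P f (\<psi>F n xs) y R R')"
  have "\<exists>Z. \<forall>n. inv n (Z n) \<and> step n (Z n) (Z (Suc n))"
  proof (rule dependent_nat_choice)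
    show "\<exists>z. inv 0 z"
      by (rule exI[of _ "([], {})"]) (simp add: inv_def tuples_def)
    fix z n assume z: "inv n z"
    obtain xs R where z_eq: "z = (xs, R)" by (cases z)
    with z have xs: "xs \<in> tuples P n" "finite R" "R \<subseteq> good_triples pl P \<xi> c"
      by (auto simp: inv_def)
    obtain y R' where "y \<in> P \<rightarrow>\<^sub>E UNIV" "\<forall>t\<in>P. y t \<in> St t \<inter> phi pl UNIV (\<psi>S n xs)"
      "finite R'" "R' \<subseteq> good_triples pl P \<xi> c" "extends_triples pl P f (\<psi>F n xs) y R R'"
      using exists_next[OF assms(1,2,4-7) _ _ assms(9)[OF xs(1)] xs(2,3)] assms(8)[OF xs(1)]
      by metis
    then show "\<exists>z'. inv (Suc n) z' \<and> step n z z'"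
      using xs(1) by (intro exI[of _ "(xs @ [y], R')"]) (simp add: inv_def step_def z_eq tuples_def)
  qed
  then obtain Z where Z: "\<And>n. inv n (Z n)" "\<And>n. step n (Z n) (Z (Suc n))" by blast
  \<comment> \<open>The list at stage \<open>Suc n\<close> has entries with indices \<open>0\<close>
    to \<open>n\<close>, so its last one is the function chosen at stage \<open>n\<close>.\<close>
  define x where "x = (\<lambda>n. last (fst (Z (Suc n))))"
  define R where "R = (\<lambda>n. snd (Z n))"
  have xs_Suc: "fst (Z (Suc n)) = fst (Z n) @ [x n]" for n
    using Z(2)[of n] by (auto simp: step_def x_def split: prod.splits)
  have xs: "fst (Z n) = map x [0..<n]" for n
  proof (induction n)
    case 0
    show ?case using Z(1)[of 0] by (auto simp: inv_def tuples_def)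
  qed (simp add: xs_Suc)
  have x: "x n \<in> P \<rightarrow>\<^sub>E UNIV" "\<forall>t\<in>P. x n t \<in> St t \<inter> phi pl UNIV (\<psi>S n (map x [0..<n]))"
    and ext: "extends_triples pl P f (\<psi>F n (map x [0..<n])) (x n) (R n) (R (Suc n))" for n
    using Z(2)[of n] xs[of n] xs_Suc[of n]
    by (auto simp: step_def R_def split: prod.splits)
  have R: "R n \<subseteq> good_triples pl P \<xi> c" for n
    using Z(1)[of n] by (auto simp: inv_def R_def split: prod.splits)
  have "\<exists>s. psum pl (\<lambda>i. \<tau> i (x (n i) (t i))) l = Some s \<and> c s = color_ext c (\<xi> tmin)"
    if h: "strict_mono_on {..l} n" "\<forall>i\<le>l. t i \<in> P"
      "\<forall>i\<le>l. \<tau> i \<in> \<psi>F (n i) (map x [0..<n i])"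
      "Complete_Partial_Order.chain (\<le>) ((\<lambda>i. f (\<tau> i) (t i)) ` {..l})"
      and tmin: "tmin \<in> (\<lambda>i. f (\<tau> i) (t i)) ` {..l}" "\<forall>i\<le>l. tmin \<le> f (\<tau> i) (t i)"
    for l n t \<tau> tmin
  proof -
    obtain s m where s: "psum pl (\<lambda>i. \<tau> i (x (n i) (t i))) l = Some s"
      "(s, (\<lambda>i. f (\<tau> i) (t i)) ` {..l}, m) \<in> good_triples pl P \<xi> c"
      using psum_in_triples[where T = "\<lambda>n. \<psi>F n (map x [0..<n])", OF ext h] R by blast
    \<comment> \<open>Both are least elements of the same set of positions.\<close>
    then have "m = tmin" "c s = color_ext c (\<xi> m)"
      using tmin by (auto simp: good_triples_def good_sum_def intro!: antisym)
    with s(1) show ?thesis by simp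
  qed
  with x show ?thesis by (intro exI[of _ x]) simp
qed

end
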